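(* Let $p>2$ be a real number. Consider, for a real sequence $a=(a_n)_{n\in\mathbb{Z}}$ and $s\in\{1,-1\}$, the stationary discrete $p$-Schrödinger equation $$-s\,a_n=(\Delta_p a)_n,\qquad n\in\mathbb{Z}.\qquad ( * )$$ (1) For $s=1$, equation $( * )$ admits two real solutions $(a_n^1)_{n\in\mathbb{Z}}$ and $(a_n^2)_{n\in\mathbb{Z}}$ such that, for $i=1,2$, $$\lim_{n\to\pm\infty}a_n^i=0,\qquad (-1)^n a_n^i>0 \ \text{ and }\ |a_n^i|>|a_{n-1}^i|\ \text{ for all integers } n\le 0,$$ and $$a_n^1=a_{-n}^1,\qquad a_n^2=-a_{-n+1}^2\qquad\text{for all } n\in\mathbb{Z}.$$ (2) For $s=-1$, the only bounded real solution of $( * )$ is the zero sequence $a_n=0$ for all $n\in\mathbb{Z}$.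
   Context: For a sequence $a=(a_n)_{n\in\mathbb{Z}}$ and $p>2$, the discrete $p$-Laplacian is $$(\Delta_p a)_n=(a_{n+1}-a_n)\,|a_{n+1}-a_n|^{p-2}-(a_n-a_{n-1})\,|a_n-a_{n-1}|^{p-2},\qquad n\in\mathbb{Z}.$$ *)

theory Defs
  imports "HOL-Analysis.Analysis"
begin

(* For p > 2 the convention 0 powr (p - 2) = 0 is the intended value of |0|^(p - 2). *)
definition discrete_p_laplacian :: "real \<Rightarrow> (int \<Rightarrow> real) \<Rightarrow> int \<Rightarrow> real" where
  "discrete_p_laplacian p a n =
     (a (n + 1) - a n) * \<bar>a (n + 1) - a n\<bar> powr (p - 2)
     - (a n - a (n - 1)) * \<bar>a n - a (n - 1)\<bar> powr (p - 2)"

definition stationary_p_schroedinger :: "real \<Rightarrow> real \<Rightarrow> (int \<Rightarrow> real) \<Rightarrow> bool" where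
  "stationary_p_schroedinger p s a \<longleftrightarrow> (\<forall>n. - s * a n = discrete_p_laplacian p a n)"

end

theory Submission
  imports Defs
begin

text \<open>For \<open>s = 1\<close> put \<open>a n = (-1)^n * b n\<close> and \<open>\<phi> x = x * |x|^(p-2)\<close>; the equation becomes
  \<open>b n = \<phi> (b n + b (n+1)) + \<phi> (b n + b (n-1))\<close>, and a solution symmetric about a site or a bond
  is determined by \<open>x = b 0\<close>. Shoot from \<open>x\<close> in \<open>(e, 1]\<close>, where \<open>e\<close> is the positive constant
  solution. The sets of \<open>x\<close> whose orbit first fails to decrease, respectively first becomes negative,
  are open and disjoint; the former contains points near \<open>e\<close>, because the linearisation there is
  oscillatory, and the latter contains 1. By connectedness some orbit stays positive and decreasing,
  and it must tend to 0. For \<open>s = -1\<close>, once a positive \<open>a\<close> does not decrease, the fluxes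
  \<open>\<phi> (a (n+1) - a n)\<close> grow at least linearly, so \<open>a\<close> is not bounded.\<close>

section \<open>The odd power function, its inverse and its regularity\<close>

section \<open>Signed powers\<close>

text \<open>With \<open>r = p - 1\<close> this is the odd nonlinearity of the p-Laplacian. For
  \<open>r > 0\<close> it is an increasing bijection of the reals with inverse
  \<open>spow (1 / r)\<close>, so the recurrence can be solved for its next term.\<close>

definition spow :: "real \<Rightarrow> real \<Rightarrow> real" where
  "spow r x = sgn x * \<bar>x\<bar> powr r"

lemma spow_0 [simp]: "spow r 0 = 0"
  by (simp add: spow_def)

lemma spow_minus [simp]: "spow r (- x) = - spow r x"
  by (simp add: spow_def)

lemma spow_pos_eq: "x > 0 \<Longrightarrow> spow r x = x powr r"
  by (simp add: spow_def)

lemma spow_nonneg_eq: "x \<ge> 0 \<Longrightarrow> spow r x = x powr r"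
  by (cases "x = 0") (auto simp: spow_def)

lemma mult_abs_powr_eq_spow: "x * \<bar>x\<bar> powr (r - 1) = spow r x"
  by (cases "x = 0") (auto simp: spow_def powr_diff sgn_if)

lemma spow_strict_mono:
  assumes "r > 0" "x < y"
  shows "spow r x < spow r y"
proof -
  consider "0 \<le> x" | "x < 0" "0 \<le> y" | "y < 0" by linarith
  then show ?thesis
  proof cases
    case 1
    then show ?thesis using assms by (simp add: spow_nonneg_eq powr_less_mono2)
  next
    case 2
    have "spow r x < 0" using 2 by (simp add: spow_def)
    also have "0 \<le> spow r y" using 2 by (simp add: spow_nonneg_eq)
    finally show ?thesis .
  next
    case 3
    have "spow r (- y) < spow r (- x)"
      using 3 assms by (simp add: spow_nonneg_eq powr_less_mono2 del: spow_minus)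
    then show ?thesis by simp
  qed
qed

lemma spow_less_iff [simp]: "r > 0 \<Longrightarrow> spow r x < spow r y \<longleftrightarrow> x < y"
  by (metis spow_strict_mono not_less_iff_gr_or_eq)

lemma spow_le_iff [simp]: "r > 0 \<Longrightarrow> spow r x \<le> spow r y \<longleftrightarrow> x \<le> y"
  by (simp add: linorder_not_less [symmetric])

lemma spow_eq_iff [simp]: "r > 0 \<Longrightarrow> spow r x = spow r y \<longleftrightarrow> x = y"
  by (simp add: eq_iff)

lemma spow_root_left [simp]: "r > 0 \<Longrightarrow> spow (1 / r) (spow r x) = x"
  by (cases x "0 :: real" rule: linorder_cases)
     (auto simp: spow_def sgn_mult abs_mult powr_powr)

lemma spow_root_right [simp]: "r > 0 \<Longrightarrow> spow r (spow (1 / r) x) = x"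
  using spow_root_left [of "1 / r" x] by simp

text \<open>At 0 the function is squeezed by \<open>\<bar>x\<bar> powr r\<close>; elsewhere the
  product form has a nonzero base and the standard rules apply.\<close>

lemma isCont_spow:
  assumes "r > 0"
  shows "isCont (spow r) x"
proof (cases "x = 0")
  case True
  have "((\<lambda>x. \<bar>x\<bar> powr r) \<longlongrightarrow> \<bar>0 :: real\<bar> powr r) (at 0)"
    by (intro tendsto_powr' tendsto_intros) (use assms in auto)
  then have "((\<lambda>x. \<bar>x :: real\<bar> powr r) \<longlongrightarrow> 0) (at 0)" by simp
  then have "((\<lambda>x. spow r x) \<longlongrightarrow> 0) (at 0)"
    by (rule Lim_null_comparison [rotated])
       (auto simp: spow_def abs_mult sgn_if intro!: always_eventually)
  then show ?thesis using True by (simp add: isCont_def)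
next
  case False
  have "isCont (\<lambda>x. x * \<bar>x\<bar> powr (r - 1)) x"
    using False by (intro continuous_intros) auto
  then show ?thesis by (simp add: mult_abs_powr_eq_spow)
qed

lemma continuous_on_spow [continuous_intros]:
  assumes "r > 0" "continuous_on A f"
  shows "continuous_on A (\<lambda>x. spow r (f x))"
proof -
  have "continuous_on UNIV (spow r)"
    using isCont_spow [OF assms(1)] by (simp add: continuous_at_imp_continuous_on)
  from continuous_on_compose2 [OF this assms(2)] show ?thesis by simp
qed

lemma DERIV_spow:
  assumes "x > 0"
  shows "(spow r has_real_derivative r * x powr (r - 1)) (at x)"
proof -
  have "((\<lambda>x. x powr r) has_real_derivative r * x powr (r - 1)) (at x)"
    using assms by (auto intro!: derivative_eq_intros)
  then show ?thesis
    by (rule DERIV_cong_ev [THEN iffD1, rotated -1])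
       (use assms in \<open>auto simp: spow_pos_eq intro: eventually_mono [OF eventually_nhds_in_open [of "{0<..}" x]]\<close>)
qed

lemma spow_midpoint_convex:
  assumes "r \<ge> 1" "x > 0" "y > 0"
  shows "2 * spow r ((x + y) / 2) \<le> spow r x + spow r y"
proof -
  have "convex_on {0<..} (\<lambda>x :: real. x powr r)"
  proof (rule f''_ge0_imp_convex)
    show "((\<lambda>x. x powr r) has_real_derivative r * x powr (r - 1)) (at x)" if "x \<in> {0<..}" for x :: real
      using that by (auto intro!: derivative_eq_intros)
    show "((\<lambda>x. r * x powr (r - 1)) has_real_derivative r * ((r - 1) * x powr (r - 2))) (at x)"
      if "x \<in> {0<..}" for x :: real
      using that by (auto intro!: derivative_eq_intros)
  qed (use assms(1) in auto)
  then have "((1 - 1/2) *\<^sub>R x + (1/2) *\<^sub>R y) powr r \<le> (1 - 1/2) * x powr r + (1/2) * y powr r"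
    by (rule convex_onD) (use assms in auto)
  then have "((x + y) / 2) powr r \<le> (x powr r + y powr r) / 2"
    by (simp add: field_simps)
  then show ?thesis using assms by (simp add: spow_pos_eq)
qed

section \<open>The positive constant solution\<close>

text \<open>The positive number \<open>e\<close> with \<open>e = 2 * spow r (2 * e)\<close>.\<close>

definition fixpt :: "real \<Rightarrow> real" where
  "fixpt r = (1/4) powr (1 / (r - 1)) / 2"

lemma fixpt_pos: "fixpt r > 0"
  by (simp add: fixpt_def)

lemma fixpt_powr: "r > 1 \<Longrightarrow> (2 * fixpt r) powr (r - 1) = 1/4"
  by (simp add: fixpt_def powr_powr)

lemma fixpt_less_1:
  assumes "r > 1"
  shows "fixpt r < 1"
proof -
  have "(1/4 :: real) powr (1 / (r - 1)) \<le> 1 powr (1 / (r - 1))"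
    using assms by (intro powr_mono2) auto
  then show ?thesis by (simp add: fixpt_def)
qed

text \<open>The factor \<open>4 * (2 * t) powr (r - 1)\<close> is increasing in \<open>t\<close> for
  \<open>r > 1\<close> and equals 1 at \<open>fixpt r\<close>, which decides on which side of the
  constant solution each inequality holds.\<close>

lemma twice_spow_twice:
  assumes "t > 0"
  shows "2 * spow r (2 * t) = t * (4 * (2 * t) powr (r - 1))"
  using assms by (simp add: spow_pos_eq powr_diff)

lemma spow_fixpt:
  assumes "r > 1"
  shows "spow r (2 * fixpt r) = fixpt r / 2"
  using twice_spow_twice [OF fixpt_pos, of r r] fixpt_powr [OF assms] by simp

lemma spow_root_fixpt:
  assumes "r > 1"
  shows "spow (1 / r) (fixpt r / 2) = 2 * fixpt r"
  using spow_root_left [of r "2 * fixpt r"] assms by (simp only: spow_fixpt)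

lemma fixpt_diff_spow: "r > 1 \<Longrightarrow> fixpt r - spow r (2 * fixpt r) = fixpt r / 2"
  by (simp add: spow_fixpt)

lemma less_twice_spow:
  assumes "r > 1" "t > fixpt r"
  shows "t < 2 * spow r (2 * t)"
proof -
  have t: "t > 0" using assms fixpt_pos [of r] by linarith
  have "(2 * fixpt r) powr (r - 1) < (2 * t) powr (r - 1)"
    using assms fixpt_pos [of r] by (intro powr_less_mono2) auto
  then have "1 < 4 * (2 * t) powr (r - 1)" using fixpt_powr [OF assms(1)] by simp
  then show ?thesis using t by (simp add: twice_spow_twice)
qed

lemma twice_spow_less:
  assumes "r > 1" "0 < t" "t < fixpt r"
  shows "2 * spow r (2 * t) < t"
proof -
  have "(2 * t) powr (r - 1) < (2 * fixpt r) powr (r - 1)"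
    using assms by (intro powr_less_mono2) auto
  then have "4 * (2 * t) powr (r - 1) < 1" using fixpt_powr [OF assms(1)] by simp
  then show ?thesis using assms(2) by (simp add: twice_spow_twice)
qed

lemma DERIV_spow_fixpt:
  assumes "r > 1"
  shows "(spow r has_real_derivative r / 4) (at (2 * fixpt r))"
  using DERIV_spow [of "2 * fixpt r" r] fixpt_pos [of r] fixpt_powr [OF assms] by simp

lemma DERIV_spow_root_fixpt:
  assumes "r > 1"
  shows "(spow (1 / r) has_real_derivative 4 / r) (at (fixpt r / 2))"
proof -
  have "(spow (1 / r) has_real_derivative inverse (r / 4)) (at (fixpt r / 2))"
  proof (rule DERIV_inverse_function [where f = "spow r" and a = 0 and b = "fixpt r"])
    show "(spow r has_real_derivative r / 4) (at (spow (1 / r) (fixpt r / 2)))"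
      unfolding spow_root_fixpt [OF assms] by (rule DERIV_spow_fixpt [OF assms])
  qed (use assms fixpt_pos [of r] isCont_spow in auto)
  then show ?thesis by simp
qed

section \<open>Positive decreasing half-line orbits by connectedness\<close>

section \<open>Shooting\<close>

text \<open>The last clause is the recurrence solved for its newest term. The second value
  \<open>G x\<close> is left open: it encodes the equation at the centre of symmetry, so one
  argument serves both kinds of centre.\<close>

fun shoot :: "real \<Rightarrow> (real \<Rightarrow> real) \<Rightarrow> real \<Rightarrow> nat \<Rightarrow> real" where
  "shoot r G x 0 = x"
| "shoot r G x (Suc 0) = G x"
| "shoot r G x (Suc (Suc k)) =
     spow (1 / r) (shoot r G x (Suc k) - spow r (shoot r G x (Suc k) + shoot r G x k))
       - shoot r G x (Suc k)"

lemma shoot_recurrence: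
  assumes "r > 0"
  shows "shoot r G x (Suc k) =
    spow r (shoot r G x (Suc k) + shoot r G x k)
    + spow r (shoot r G x (Suc k) + shoot r G x (Suc (Suc k)))"
  using assms by simp

lemma continuous_on_shoot:
  assumes "r > 0" "continuous_on UNIV G"
  shows "continuous_on UNIV (\<lambda>x. shoot r G x k)"
proof (induction k rule: induct_nat_012)
  case (ge2 k)
  then show ?case using assms(1) by (auto intro!: continuous_intros)
qed (use assms(2) in auto)

text \<open>At the constant solution the linearised recurrence is a discrete oscillator, so its solutions
  cannot decrease forever.\<close>

lemma oscillator_increases_somewhere:
  fixes d :: "nat \<Rightarrow> real"
  assumes mu: "\<mu> > 0" and d1: "d 1 < d 0"
    and rec: "\<And>k. d (Suc (Suc k)) = 2 * d (Suc k) - d k - \<mu> * d (Suc k)"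
  shows "\<exists>k. d k < d (Suc k)"
proof (rule ccontr)
  assume "\<not> ?thesis"
  then have decr: "d (Suc k) \<le> d k" for k by (simp add: not_less)
  have mono: "d (k + j) \<le> d k" for k j
    by (induction j) (use decr order_trans in auto)
  show False
  proof (cases "\<exists>k. d k < 0")
    case True
    then obtain k where k: "d k < 0" by blast
    \<comment> \<open>After a negative value every later value is at most \<open>d k\<close>, so
      each increment exceeds the previous one by at least \<open>\<mu> * (- d k)\<close> and
      eventually becomes positive.\<close>
    have step: "d (Suc (k + j)) - d (k + j) \<ge> d (Suc k) - d k + real j * (\<mu> * (- d k))" for j
    proof (induction j)
      case (Suc j)
      have "\<mu> * d (k + Suc j) \<le> \<mu> * d k" using mono [of k "Suc j"] mu by simp
      then show ?case using Suc rec [of "k + j"] by (simp add: algebra_simps)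
    qed simp
    have "\<mu> * (- d k) > 0" using k mu by (simp add: mult_pos_neg)
    then obtain j where "real j * (\<mu> * (- d k)) > d k - d (Suc k)"
      using reals_Archimedean3 by blast
    then show False using step [of j] decr [of "k + j"] by linarith
  next
    case False
    then have nn: "d k \<ge> 0" for k by (simp add: not_less)
    \<comment> \<open>While the values are nonnegative the increments cannot grow, so
      \<open>d\<close> falls at least linearly and must turn negative.\<close>
    have step: "d (Suc k) - d k \<le> d 1 - d 0" for k
    proof (induction k)
      case (Suc k)
      have "\<mu> * d (Suc k) \<ge> 0" using mu nn by simp
      then show ?case using Suc rec [of k] by linarith
    qed simp
    have "d k \<le> d 0 - real k * (d 0 - d 1)" for k
    proof (induction k)
      case (Suc k)
      then show ?case using step [of k] by (simp add: algebra_simps)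
    qed simp
    moreover obtain k where "real k * (d 0 - d 1) > d 0"
      using reals_Archimedean3 d1 by (metis diff_gt_0_iff_gt)
    ultimately show False using nn [of k] by (smt (verit))
  qed
qed

text \<open>The chain rule with slopes \<open>r / 4\<close> and \<open>4 / r\<close> of the power
  and its root; the result is written as the oscillator step with \<open>\<mu> = 4 - 4 / r\<close>,
  positive for \<open>r > 1\<close>.\<close>

lemma DERIV_shoot_fixpt_step:
  fixes u v :: "real \<Rightarrow> real"
  assumes r: "r > 1" and u: "(u has_real_derivative a) (at x)" "u x = fixpt r"
    and v: "(v has_real_derivative b) (at x)" "v x = fixpt r"
  shows "((\<lambda>x. spow (1 / r) (v x - spow r (v x + u x)) - v x)
          has_real_derivative 2 * b - a - (4 - 4 / r) * b) (at x)"
proof -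
  have "((\<lambda>x. spow r (v x + u x)) has_real_derivative r / 4 * (b + a)) (at x)"
    by (rule DERIV_chain2 [where f = "spow r"])
       (use DERIV_spow_fixpt [OF r] u v in \<open>auto intro!: derivative_eq_intros\<close>)
  then have "((\<lambda>x. v x - spow r (v x + u x)) has_real_derivative b - r / 4 * (b + a)) (at x)"
    by (intro DERIV_diff v)
  moreover have "v x - spow r (v x + u x) = fixpt r / 2"
    using spow_fixpt [OF r] u v by simp
  ultimately have "((\<lambda>x. spow (1 / r) (v x - spow r (v x + u x)))
      has_real_derivative 4 / r * (b - r / 4 * (b + a))) (at x)"
    by (intro DERIV_chain2 [where f = "spow (1 / r)"])
       (simp_all only: DERIV_spow_root_fixpt [OF r])
  from DERIV_diff [OF this v(1)] show ?thesis
    by (rule DERIV_cong) (use r in \<open>simp add: field_simps\<close>)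
qed

text \<open>To first order the \<open>k\<close>-th term started at \<open>e + h\<close> is
  \<open>e + d k * h\<close>. Hence a rise in \<open>d\<close> forces a rise in the orbit for small
  \<open>h > 0\<close>, while the finitely many terms up to there stay near
  \<open>e > 0\<close>.\<close>

lemma shooting_increase_near_fixpt:
  assumes r: "r > 1" and cont: "continuous_on UNIV G"
    and Ge: "G (fixpt r) = fixpt r"
    and dG: "(G has_real_derivative g) (at (fixpt r))" and g: "g < 1"
  shows "\<exists>x\<in>{fixpt r<..1}. \<exists>k. shoot r G x k < shoot r G x (Suc k) \<and> (\<forall>j\<le>k. shoot r G x j > 0)"
proof -
  define e where "e = fixpt r"
  define u where "u = (\<lambda>k x. shoot r G x k)"
  define d where "d = (\<lambda>k. deriv (u k) e)"
  have e: "0 < e" "e < 1" using fixpt_pos [of r] fixpt_less_1 [OF r] by (auto simp: e_def)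
  have ue: "u k e = e" for k
  proof (induction k rule: induct_nat_012)
    case (ge2 k)
    then show ?case
      using fixpt_diff_spow [OF r] spow_root_fixpt [OF r]
      by (simp only: e_def u_def shoot.simps mult_2 [symmetric])
  qed (simp_all add: e_def u_def Ge)
  have u0: "(u 0 has_real_derivative 1) (at e)" and u1: "(u (Suc 0) has_real_derivative g) (at e)"
    using dG by (auto simp: u_def e_def)
  have ustep: "(u (Suc (Suc k)) has_real_derivative 2 * b - a - (4 - 4 / r) * b) (at e)"
    if "(u k has_real_derivative a) (at e)" "(u (Suc k) has_real_derivative b) (at e)" for k a b
    using DERIV_shoot_fixpt_step [OF r that(1) _ that(2)] ue e_def by (simp add: u_def)
  have du: "(u k has_real_derivative d k) (at e)" for k
  proof (induction k rule: induct_nat_012)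
    case (ge2 k)
    from ustep [OF ge2] show ?case unfolding d_def by (metis DERIV_imp_deriv)
  qed (use u0 u1 in \<open>auto simp: d_def DERIV_imp_deriv\<close>)
  have "\<exists>k. d k < d (Suc k)"
  proof (rule oscillator_increases_somewhere)
    show "4 - 4 / r > 0" using r by (simp add: field_simps)
    show "d 1 < d 0" using DERIV_imp_deriv [OF u0] DERIV_imp_deriv [OF u1] g by (simp add: d_def)
    show "d (Suc (Suc k)) = 2 * d (Suc k) - d k - (4 - 4 / r) * d (Suc k)" for k
      using ustep [OF du du] by (rule DERIV_unique [OF du])
  qed
  then obtain k where k: "d k < d (Suc k)" by blast
  \<comment> \<open>Both terms equal \<open>e\<close> at the start \<open>e\<close>, so their
    difference vanishes there and has positive slope.\<close>
  obtain \<delta> where \<delta>: "\<delta> > 0" "\<And>h. 0 < h \<Longrightarrow> h < \<delta> \<Longrightarrow> u k (e + h) < u (Suc k) (e + h)"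
    using DERIV_pos_inc_right [OF DERIV_diff [OF du [of "Suc k"] du [of k]]] k ue by auto
  have ev1: "\<forall>\<^sub>F x in at_right e. u k x < u (Suc k) x"
    unfolding eventually_at_right_field
    by (rule exI [of _ "e + \<delta>"]) (use \<delta>(1) \<delta>(2) [of "y - e" for y] in auto)
  have "\<forall>\<^sub>F x in at_right e. 0 < u j x" for j
  proof -
    have "continuous_on UNIV (u j)" using continuous_on_shoot [OF _ cont, of r j] r by (simp add: u_def)
    then have "(u j \<longlongrightarrow> u j e) (at_right e)"
      by (simp add: continuous_on_eq_continuous_at isCont_def filterlim_at_split)
    then show ?thesis using e ue by (simp add: order_tendstoD)
  qed
  then have ev2: "\<forall>\<^sub>F x in at_right e. \<forall>j\<in>{..k}. 0 < u j x"
    by (intro eventually_ball_finite) auto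
  have ev3: "\<forall>\<^sub>F x in at_right e. x \<in> {e<..<1}"
    using e eventually_at_right_real by blast
  from eventually_happens' [OF _ eventually_conj [OF ev1 eventually_conj [OF ev2 ev3]]]
  obtain x where "u k x < u (Suc k) x" "\<forall>j\<in>{..k}. 0 < u j x" "x \<in> {e<..<1}"
    by auto
  then show ?thesis by (intro bexI [of _ x] exI [of _ k]) (auto simp: u_def e_def)
qed

lemma shooting_exists:
  assumes r: "r > 1" and cont: "continuous_on UNIV G"
    and Ge: "G (fixpt r) = fixpt r"
    and dG: "(G has_real_derivative g) (at (fixpt r))" and g: "g < 1"
    and Gless: "\<And>x. x > fixpt r \<Longrightarrow> G x < x" and G1: "G 1 < 0"
  shows "\<exists>x. \<forall>k. 0 < shoot r G x k \<and> shoot r G x (Suc k) < shoot r G x k"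
proof (rule ccontr)
  assume no: "\<not> ?thesis"
  define I where "I = {fixpt r<..1}"
  define u where "u = shoot r G"
  \<comment> \<open>\<open>A\<close> detects a rise among positive values, \<open>B\<close> a
    negative value after strict decrease. Strict inequalities make both open; the borderline cases
    of a repeated or a zero value are decided by continuing the orbit.\<close>
  define A where "A = (\<Union>k. {x. u x k < u x (Suc k)} \<inter> (\<Inter>j\<in>{..k}. {x. 0 < u x j}))"
  define B where "B = (\<Union>k. {x. u x k < 0} \<inter> (\<Inter>j\<in>{..<k}. {x. u x (Suc j) < u x j}))"
  have cu: "continuous_on UNIV (\<lambda>x. u x k)" for k
    using continuous_on_shoot [OF _ cont] r by (simp add: u_def)
  have rec: "u x (Suc k) = spow r (u x (Suc k) + u x k) + spow r (u x (Suc k) + u x (Suc (Suc k)))"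
    for x k
    unfolding u_def by (rule shoot_recurrence) (use r in simp)
  have "open A" unfolding A_def
    by (intro open_UN open_Int open_INT ballI open_Collect_less cu continuous_on_const) auto
  moreover have "open B" unfolding B_def
    by (intro open_UN open_Int open_INT ballI open_Collect_less cu continuous_on_const) auto
  moreover have "A \<inter> B \<inter> I = {}"
  proof -
    \<comment> \<open>The rise at \<open>k\<close> cannot precede \<open>m\<close>, so
      \<open>m \<le> k\<close>, and the term at \<open>m\<close> would be both positive and
      negative.\<close>
    have False if "u x k < u x (Suc k)" "\<forall>j\<le>k. 0 < u x j" "u x m < 0" "\<forall>j<m. u x (Suc j) < u x j"
      for x k m
      using that by (metis not_less_iff_gr_or_eq linorder_not_le)
    then show ?thesis unfolding A_def B_def by force
  qed
  moreover have "A \<inter> I \<noteq> {}"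
    using shooting_increase_near_fixpt [OF r cont Ge dG g]
    unfolding A_def I_def u_def by auto
  moreover have "B \<inter> I \<noteq> {}"
  proof -
    have "1 \<in> B" unfolding B_def
      by (rule UN_I [of 1]) (use G1 in \<open>auto simp: u_def\<close>)
    then show ?thesis using fixpt_less_1 [OF r] by (auto simp: I_def)
  qed
  moreover have "I \<subseteq> A \<union> B"
  proof
    fix x assume x: "x \<in> I"
    then have x0: "x > 0" "G x < x" using fixpt_pos [of r] Gless by (auto simp: I_def)
    define k where "k = (LEAST k. \<not> (0 < u x (Suc k) \<and> u x (Suc k) < u x k))"
    have "\<exists>k. \<not> (0 < u x (Suc k) \<and> u x (Suc k) < u x k)"
    proof (rule ccontr)
      assume *: "\<not> ?thesis"
      then have "0 < u x k \<and> u x (Suc k) < u x k" for k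
        using x0 by (cases k) (auto simp: u_def simp del: shoot.simps(3))
      then show False using no by (auto simp: u_def)
    qed
    then have k: "\<not> (0 < u x (Suc k) \<and> u x (Suc k) < u x k)"
      unfolding k_def by (rule LeastI_ex)
    have below: "0 < u x (Suc j) \<and> u x (Suc j) < u x j" if "j < k" for j
      using not_less_Least [OF that [unfolded k_def]] by blast
    have pos: "0 < u x j" if "j \<le> k" for j
      using below [of "j - 1"] that x0 by (cases j) (auto simp: u_def)
    consider "u x k < u x (Suc k)" | "u x (Suc k) = u x k" | "u x (Suc k) < 0"
      | "u x (Suc k) = 0" using k by linarith
    then show "x \<in> A \<union> B"
    proof cases
      case 1
      then have "x \<in> A" unfolding A_def using pos by auto
      then show ?thesis ..
    next
      case 2
      \<comment> \<open>A repetition cannot occur at the first step because \<open>G x < x\<close>,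
        so a predecessor exists.\<close>
      then obtain m where m: "k = Suc m" using x0 by (cases k) (auto simp: u_def)
      text \<open>The recurrence is reversible, so the orbit is symmetric about the repeated value.\<close>
      have "spow r (u x (Suc m) + u x m) = spow r (u x (Suc m) + u x (Suc (Suc k)))"
        using rec [of x m] rec [of x "Suc m"] unfolding m 2 [unfolded m] by linarith
      then have "u x (Suc (Suc k)) = u x m" using r by simp
      then have "u x (Suc k) < u x (Suc (Suc k))" using below [of m] 2 m by simp
      moreover have "\<forall>j\<le>Suc k. 0 < u x j" using pos 2 by (auto simp: le_Suc_eq)
      ultimately have "x \<in> A" unfolding A_def by blast
      then show ?thesis ..
    next
      case 3
      then have "u x (Suc k) < u x k" using pos [of k] by simp
      then have "x \<in> B" unfolding B_def using 3 below by (auto simp: less_Suc_eq intro!: exI [of _ "Suc k"])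
      then show ?thesis ..
    next
      case 4
      \<comment> \<open>After a zero the recurrence returns the negative of the preceding value, so
        the orbit is negative one step later.\<close>
      have "u x (Suc (Suc k)) = - u x k" using 4 r by (simp add: u_def)
      then have "u x (Suc (Suc k)) < 0" "u x (Suc (Suc k)) < u x (Suc k)" "u x (Suc k) < u x k"
        using pos [of k] 4 by auto
      then have "x \<in> B" unfolding B_def using below
        by (auto simp: less_Suc_eq intro!: exI [of _ "Suc (Suc k)"])
      then show ?thesis ..
    qed
  qed
  moreover have "connected I" by (simp add: I_def)
  ultimately show False unfolding connected_def by (metis Int_commute)
qed

text \<open>The sequence cannot stay above the fixed point: there convexity makes it strictly concave,
  which contradicts boundedness. Once below, its limit can only be the other fixed point, zero.\<close>

lemma decreasing_orbit_tendsto_0: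
  assumes r: "r > 1"
    and rec: "\<And>k. c (Suc k) = spow r (c (Suc k) + c k) + spow r (c (Suc k) + c (Suc (Suc k)))"
    and pos: "\<And>k. 0 < c k" and decr: "\<And>k. c (Suc k) < c k"
  shows "c \<longlonglongrightarrow> (0 :: real)"
proof -
  have dec: "decseq c" using decr by (intro decseq_SucI) (simp add: less_imp_le)
  obtain L where L: "c \<longlonglongrightarrow> L" "\<And>k. L \<le> c k"
    using decseq_convergent [OF dec, of 0] pos by (auto simp: less_imp_le)
  have L0: "L \<ge> 0" using L(1) pos by (intro LIMSEQ_le_const) (auto simp: less_imp_le)
  have "\<exists>k. c k \<le> fixpt r"
  proof (rule ccontr)
    assume "\<not> ?thesis"
    then have big: "c k > fixpt r" for k by (simp add: not_le)
    have concave: "c k + c (Suc (Suc k)) < 2 * c (Suc k)" for k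
    proof -
      \<comment> \<open>The midpoint of the two neighbours: convexity bounds
        \<open>2 * spow r (c (Suc k) + m)\<close> by \<open>c (Suc k)\<close>, which above the fixed
        point is less than the same expression with \<open>c (Suc k)\<close> in place of
        \<open>m\<close>.\<close>
      define m where "m = (c k + c (Suc (Suc k))) / 2"
      have "2 * spow r (c (Suc k) + m) \<le> c (Suc k)"
        using spow_midpoint_convex [of r "c (Suc k) + c k" "c (Suc k) + c (Suc (Suc k))"]
          r pos [of k] pos [of "Suc k"] pos [of "Suc (Suc k)"] rec [of k]
        by (simp add: m_def field_simps)
      also have "\<dots> < 2 * spow r (2 * c (Suc k))" by (rule less_twice_spow [OF r big])
      finally show ?thesis using r by (simp add: m_def)
    qed
    have step: "c (Suc k) - c k \<le> c 1 - c 0" for k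
    proof (induction k)
      case (Suc k)
      then show ?case using concave [of k] by simp
    qed simp
    have "c k \<le> c 0 - real k * (c 0 - c 1)" for k
    proof (induction k)
      case (Suc k)
      then show ?case using step [of k] by (simp add: algebra_simps)
    qed simp
    moreover obtain k where "real k * (c 0 - c 1) > c 0"
      using reals_Archimedean3 decr [of 0] by (metis One_nat_def diff_gt_0_iff_gt)
    ultimately show False using pos [of k] by (smt (verit))
  qed
  then obtain k where "c k \<le> fixpt r" by blast
  then have Lless: "L < fixpt r" using decr [of k] L(2) [of "Suc k"] by linarith
  have lim1: "(\<lambda>k. c (Suc k)) \<longlonglongrightarrow> L" and lim2: "(\<lambda>k. c (Suc (Suc k))) \<longlonglongrightarrow> L"
    using L(1) LIMSEQ_Suc by blast+
  have sp: "(\<lambda>k. spow r (f k)) \<longlonglongrightarrow> spow r l" if "f \<longlonglongrightarrow> l" for f l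
    using isCont_tendsto_compose [OF isCont_spow that] r by simp
  have "(\<lambda>k. c (Suc k)) \<longlonglongrightarrow> spow r (L + L) + spow r (L + L)"
    using tendsto_add [OF sp [OF tendsto_add [OF lim1 L(1)]] sp [OF tendsto_add [OF lim1 lim2]]]
    by (simp only: rec [symmetric])
  from LIMSEQ_unique [OF lim1 this] have "2 * spow r (2 * L) = L" by (simp only: mult_2)
  then have "\<not> 0 < L" using twice_spow_less [OF r _ Lless] by (metis less_irrefl)
  with L0 have "L = 0" by simp
  then show ?thesis using L(1) by simp
qed

text \<open>The recurrence holds at indices from 1 on; \<open>c 1 = G (c 0)\<close> supplies the
  missing equation at index 0.\<close>

lemma shooting:
  assumes r: "r > 1" and cont: "continuous_on UNIV G"
    and Ge: "G (fixpt r) = fixpt r"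
    and dG: "(G has_real_derivative g) (at (fixpt r))" and g: "g < 1"
    and Gless: "\<And>x. x > fixpt r \<Longrightarrow> G x < x" and G1: "G 1 < 0"
  obtains c where "c 1 = G (c 0)"
    and "\<And>k. c (Suc k) = spow r (c (Suc k) + c k) + spow r (c (Suc k) + c (Suc (Suc k)))"
    and "\<And>k. 0 < c k" and "\<And>k. c (Suc k) < c k" and "c \<longlonglongrightarrow> 0"
proof -
  obtain x where x: "\<And>k. 0 < shoot r G x k" "\<And>k. shoot r G x (Suc k) < shoot r G x k"
    using shooting_exists [OF assms] by blast
  have rec: "shoot r G x (Suc k) = spow r (shoot r G x (Suc k) + shoot r G x k)
      + spow r (shoot r G x (Suc k) + shoot r G x (Suc (Suc k)))" for k
    by (rule shoot_recurrence) (use r in simp)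
  show thesis
  proof (rule that [of "shoot r G x"])
    show "shoot r G x \<longlonglongrightarrow> 0"
      by (rule decreasing_orbit_tendsto_0 [OF r]) (use x rec in blast)+
  qed (use x rec in \<open>simp_all del: shoot.simps(3)\<close>)
qed

section \<open>From half-line orbits to staggered solutions\<close>

section \<open>Solutions on the integers\<close>

lemma discrete_p_laplacian_spow:
  "discrete_p_laplacian p a n = spow (p - 1) (a (n + 1) - a n) - spow (p - 1) (a n - a (n - 1))"
  using mult_abs_powr_eq_spow [of _ "p - 1"] by (simp add: discrete_p_laplacian_def)

lemma minus_one_powi_cases:
  obtains "(-1 :: real) powi n = 1" | "(-1 :: real) powi n = -1"
  by (cases "even n") (auto simp: power_int_minus_left)

text \<open>Alternating signs turn differences into sums, and oddness of \<open>spow\<close> pulls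
  the common sign out.\<close>

lemma staggered_stationary:
  assumes "\<And>n. b n = spow (p - 1) (b n + b (n + 1)) + spow (p - 1) (b n + b (n - 1))"
  shows "stationary_p_schroedinger p 1 (\<lambda>n. (-1) powi n * b n)"
proof -
  have "- 1 * ((-1) powi n * b n) = discrete_p_laplacian p (\<lambda>n. (-1) powi n * b n) n" for n
  proof -
    define s :: real where "s = (-1) powi n"
    have s: "(-1 :: real) powi (n + 1) = - s" "(-1 :: real) powi (n - 1) = - s"
      by (simp_all add: s_def power_int_add power_int_diff)
    have "s * b n = s * (spow (p - 1) (b n + b (n + 1)) + spow (p - 1) (b n + b (n - 1)))"
      by (subst assms) simp
    also have "\<dots> = spow (p - 1) (s * (b n + b (n + 1))) + spow (p - 1) (s * (b n + b (n - 1)))"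
      by (rule minus_one_powi_cases [of n]) (simp_all add: s_def del: minus_add_distrib)
    also have "spow (p - 1) (s * (b n + b (n + 1))) = - spow (p - 1) (- s * b (n + 1) - s * b n)"
      by (subst spow_minus [symmetric]) (simp add: algebra_simps)
    finally show ?thesis
      unfolding discrete_p_laplacian_spow s s_def [symmetric] by (simp add: algebra_simps)
  qed
  then show ?thesis by (simp add: stationary_p_schroedinger_def)
qed

text \<open>The slack of 1 in the growth bound accommodates the bond-centred folding, where
  \<open>f n = n - 1\<close> for \<open>n > 0\<close>.\<close>

lemma tendsto_compose_int_to_nat:
  fixes f :: "int \<Rightarrow> nat" and c :: "nat \<Rightarrow> real"
  assumes "c \<longlonglongrightarrow> 0" and f: "\<And>n. \<bar>n\<bar> - 1 \<le> int (f n)"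
  shows "((\<lambda>n. (-1) powi n * c (f n)) \<longlongrightarrow> 0) at_top"
    and "((\<lambda>n. (-1) powi n * c (f n)) \<longlongrightarrow> 0) at_bot"
proof -
  have "filterlim f at_top at_top" unfolding filterlim_at_top
  proof
    fix N show "\<forall>\<^sub>F n in at_top. N \<le> f n"
      using eventually_ge_at_top [of "int N + 1"]
    proof eventually_elim
      case (elim n)
      then show ?case using f [of n] by linarith
    qed
  qed
  moreover have "filterlim f at_top at_bot" unfolding filterlim_at_top
  proof
    fix N show "\<forall>\<^sub>F n in at_bot. N \<le> f n"
      using eventually_le_at_bot [of "- int N - 1"]
    proof eventually_elim
      case (elim n)
      then show ?case using f [of n] by linarith
    qed
  qed
  ultimately have lim: "((\<lambda>n. c (f n)) \<longlongrightarrow> 0) at_top" "((\<lambda>n. c (f n)) \<longlongrightarrow> 0) at_bot"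
    using assms(1) by (blast intro: filterlim_compose)+
  have "\<bar>(-1) powi n * c (f n)\<bar> \<le> \<bar>c (f n)\<bar>" for n
    by (rule minus_one_powi_cases [of n]) simp_all
  then have *: "\<forall>\<^sub>F n in F. norm ((-1) powi n * c (f n)) \<le> \<bar>c (f n)\<bar>" for F
    by (simp add: always_eventually)
  show "((\<lambda>n. (-1) powi n * c (f n)) \<longlongrightarrow> 0) at_top"
    by (rule Lim_null_comparison [OF * tendsto_rabs_zero [OF lim(1)]])
  show "((\<lambda>n. (-1) powi n * c (f n)) \<longlongrightarrow> 0) at_bot"
    by (rule Lim_null_comparison [OF * tendsto_rabs_zero [OF lim(2)]])
qed

definition localized :: "real \<Rightarrow> (int \<Rightarrow> real) \<Rightarrow> bool" where
  "localized p a \<longleftrightarrow> stationary_p_schroedinger p 1 a \<and>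
     (a \<longlongrightarrow> 0) at_top \<and> (a \<longlongrightarrow> 0) at_bot \<and>
     (\<forall>n\<le>0. (-1) powi n * a n > 0 \<and> \<bar>a n\<bar> > \<bar>a (n - 1)\<bar>)"

text \<open>The map \<open>f\<close> folds the integers onto the orbit's indices. Moving left from 0
  follows the orbit forward, so its decrease becomes the required growth of amplitude towards
  0.\<close>

lemma localized_staggered:
  fixes f :: "int \<Rightarrow> nat"
  assumes "\<And>n. c (f n) = spow (p - 1) (c (f n) + c (f (n + 1))) + spow (p - 1) (c (f n) + c (f (n - 1)))"
    and pos: "\<And>k. 0 < c k" and decr: "\<And>k. c (Suc k) < c k" and lim: "c \<longlonglongrightarrow> 0"
    and f: "\<And>n. n \<le> 0 \<Longrightarrow> f n = nat (- n)" "\<And>n. \<bar>n\<bar> - 1 \<le> int (f n)"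
  shows "localized p (\<lambda>n. (-1) powi n * c (f n))"
proof -
  have "(-1) powi n * ((-1) powi n * c (f n)) > 0" for n
    by (rule minus_one_powi_cases [of n]) (use pos in simp_all)
  moreover have "\<bar>(-1) powi n * c (f n)\<bar> = c (f n)" for n
    by (rule minus_one_powi_cases [of n]) (use pos in \<open>simp_all add: less_imp_le\<close>)
  moreover have "c (f (n - 1)) < c (f n)" if "n \<le> 0" for n
    using decr [of "nat (- n)"] f(1) that by (simp add: nat_add_distrib Suc_nat_eq_nat_zadd1 add.commute)
  ultimately show ?thesis
    unfolding localized_def
    using staggered_stationary [of "\<lambda>n. c (f n)" p] assms(1) tendsto_compose_int_to_nat [OF lim f(2)]
    by simp
qed

lemma localized_site_centered:
  assumes "p > 2"
  shows "\<exists>a. localized p a \<and> (\<forall>n. a n = a (- n))"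
proof -
  define r where "r = p - 1"
  have r: "r > 1" using assms by (simp add: r_def)
  \<comment> \<open>By evenness the equation at site 0 is
    \<open>c 0 = 2 * spow r (c 0 + c 1)\<close>; solving for \<open>c 1\<close> gives
    \<open>G\<close>.\<close>
  define G where "G = (\<lambda>x. spow (1 / r) (x / 2) - x)"
  obtain c where c1: "c 1 = G (c 0)"
    and c: "\<And>k. c (Suc k) = spow r (c (Suc k) + c k) + spow r (c (Suc k) + c (Suc (Suc k)))"
           "\<And>k. 0 < c k" "\<And>k. c (Suc k) < c k" "c \<longlonglongrightarrow> 0"
  proof (rule shooting [OF r])
    show "continuous_on UNIV G" unfolding G_def using r by (auto intro!: continuous_intros)
    show "G (fixpt r) = fixpt r" by (simp add: G_def spow_root_fixpt [OF r])
    show "(G has_real_derivative 4 / r * (1 / 2) - 1) (at (fixpt r))" unfolding G_def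
      by (intro DERIV_diff DERIV_chain2 [where f = "spow (1 / r)"] DERIV_spow_root_fixpt [OF r])
         (auto intro!: derivative_eq_intros)
    show "4 / r * (1 / 2) - 1 < 1" using r by (simp add: field_simps)
    show "G x < x" if "x > fixpt r" for x
    proof -
      have "spow (1 / r) (x / 2) < spow (1 / r) (spow r (2 * x))"
        using less_twice_spow [OF r that] r by (intro spow_strict_mono) auto
      then show ?thesis using r by (simp add: G_def)
    qed
    show "G 1 < 0"
      using spow_strict_mono [of "1 / r" "1 / 2" 1] r by (simp add: G_def spow_pos_eq)
  qed (rule that)
  have c0: "c 0 = 2 * spow r (c 0 + c 1)" using r unfolding c1 G_def by simp
  define f where "f = (\<lambda>n :: int. nat \<bar>n\<bar>)"
  have "localized p (\<lambda>n. (-1) powi n * c (f n))"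
  proof (rule localized_staggered [OF _ c(2,3,4)])
    fix n :: int
    consider "n = 0" | k where "n = int (Suc k)" | k where "n = - int (Suc k)"
      by (metis int_cases2 not0_implies_Suc of_nat_0 minus_zero)
    then show "c (f n) = spow (p - 1) (c (f n) + c (f (n + 1))) + spow (p - 1) (c (f n) + c (f (n - 1)))"
    proof cases
      case 1
      then show ?thesis using c0 by (simp add: f_def r_def)
    next
      case 2
      then have "f n = Suc k" "f (n + 1) = Suc (Suc k)" "f (n - 1) = k" by (auto simp: f_def)
      then show ?thesis using c(1) [of k] by (simp add: r_def)
    next
      case 3
      then have "f n = Suc k" "f (n + 1) = k" "f (n - 1) = Suc (Suc k)" by (auto simp: f_def)
      then show ?thesis using c(1) [of k] by (simp add: r_def)
    qed
  qed (auto simp: f_def)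
  then show ?thesis
    by (intro exI [of _ "\<lambda>n. (-1) powi n * c (f n)"]) (simp add: f_def power_int_minus power_int_minus_left)
qed

lemma localized_bond_centered:
  assumes "p > 2"
  shows "\<exists>a. localized p a \<and> (\<forall>n. a n = - a (- n + 1))"
proof -
  define r where "r = p - 1"
  have r: "r > 1" using assms by (simp add: r_def)
  \<comment> \<open>Reflection about the bond between 0 and 1 gives both sites the value
    \<open>c 0\<close>, so the equation at 0 is
    \<open>c 0 = spow r (2 * c 0) + spow r (c 0 + c 1)\<close>, solved here for
    \<open>c 1\<close>.\<close>
  define G where "G = (\<lambda>x. spow (1 / r) (x - spow r (2 * x)) - x)"
  obtain c where c1: "c 1 = G (c 0)"
    and c: "\<And>k. c (Suc k) = spow r (c (Suc k) + c k) + spow r (c (Suc k) + c (Suc (Suc k)))"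
           "\<And>k. 0 < c k" "\<And>k. c (Suc k) < c k" "c \<longlonglongrightarrow> 0"
  proof (rule shooting [OF r])
    show "continuous_on UNIV G" unfolding G_def using r by (auto intro!: continuous_intros)
    show "G (fixpt r) = fixpt r" by (simp only: G_def fixpt_diff_spow [OF r] spow_root_fixpt [OF r])
    \<comment> \<open>This \<open>G\<close> is one shooting step from two equal values
      \<open>x\<close>, both of slope 1.\<close>
    have "((\<lambda>x. spow (1 / r) (x - spow r (x + x)) - x)
            has_real_derivative 2 * 1 - 1 - (4 - 4 / r) * 1) (at (fixpt r))"
      by (rule DERIV_shoot_fixpt_step [OF r]) auto
    then show "(G has_real_derivative 2 * 1 - 1 - (4 - 4 / r) * 1) (at (fixpt r))"
      unfolding G_def by (simp only: mult_2)
    show "2 * 1 - 1 - (4 - 4 / r) * 1 < 1" using r by (simp add: field_simps)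
    show "G x < x" if "x > fixpt r" for x
    proof -
      have "spow (1 / r) (x - spow r (2 * x)) < spow (1 / r) (spow r (2 * x))"
        using less_twice_spow [OF r that] r by (intro spow_strict_mono) auto
      then show ?thesis using r by (simp add: G_def)
    qed
    have "spow r 1 < spow r 2" using r by (intro spow_strict_mono) auto
    then have "spow (1 / r) (1 - spow r 2) < spow (1 / r) 0"
      using r by (intro spow_strict_mono) (auto simp: spow_pos_eq)
    then show "G 1 < 0" by (simp add: G_def)
  qed (rule that)
  have c0: "c 0 = spow r (c 0 + c 1) + spow r (c 0 + c 0)" using r unfolding c1 G_def by simp
  define f where "f = (\<lambda>n :: int. nat (if n \<le> 0 then - n else n - 1))"
  have "localized p (\<lambda>n. (-1) powi n * c (f n))"
  proof (rule localized_staggered [OF _ c(2,3,4)])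
    fix n :: int
    consider "n = 0" | "n = 1" | k where "n = int (Suc k) + 1" | k where "n = - int (Suc k)"
    proof (cases "n \<le> 0")
      case True
      then have "n = - int (nat (- n))" by simp
      then show thesis using that by (metis not0_implies_Suc of_nat_0 minus_zero)
    next
      case False
      then have "n = int (nat (n - 1)) + 1" by simp
      then show thesis using that by (metis not0_implies_Suc of_nat_0 add_0)
    qed
    then show "c (f n) = spow (p - 1) (c (f n) + c (f (n + 1))) + spow (p - 1) (c (f n) + c (f (n - 1)))"
    proof cases
      case 1
      then show ?thesis using c0 by (simp add: f_def r_def)
    next
      case 2
      then show ?thesis using c0 by (simp add: f_def r_def)
    next
      case 3
      then have "f n = Suc k" "f (n + 1) = Suc (Suc k)" "f (n - 1) = k" by (auto simp: f_def)
      then show ?thesis using c(1) [of k] by (simp add: r_def)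
    next
      case 4
      then have "f n = Suc k" "f (n + 1) = k" "f (n - 1) = Suc (Suc k)" by (auto simp: f_def)
      then show ?thesis using c(1) [of k] by (simp add: r_def)
    qed
  qed (auto simp: f_def)
  \<comment> \<open>The reflection preserves the amplitude but reverses the parity of the site,
    whence the minus sign.\<close>
  moreover have "f (- n + 1) = f n" for n by (auto simp: f_def)
  then have "(-1) powi n * c (f n) = - ((-1) powi (- n + 1) * c (f (- n + 1)))" for n
    by (simp add: power_int_minus_left)
  ultimately show ?thesis by blast
qed

section \<open>Bounded solutions vanish for the opposite sign\<close>

section \<open>The defocusing sign\<close>

lemma stationary_minus_one:
  "stationary_p_schroedinger p (-1) a \<longleftrightarrow>
     (\<forall>n. a n = spow (p - 1) (a (n + 1) - a n) - spow (p - 1) (a n - a (n - 1)))"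
  by (simp add: stationary_p_schroedinger_def discrete_p_laplacian_spow)

text \<open>A nonnegative flux \<open>w\<close> keeps \<open>a\<close> from falling below
  \<open>a m\<close>, and each such value adds at least \<open>a m\<close> to the flux; the two
  facts sustain each other. A bound on \<open>a\<close> would bound the flux.\<close>

lemma unbounded_if_increasing_step:
  assumes p: "p > 1" and st: "stationary_p_schroedinger p (-1) a"
    and m: "a m > 0" "a m \<le> a (m + 1)"
  shows "\<not> bounded (range a)"
proof
  assume "bounded (range a)"
  then obtain B where B: "\<And>n. \<bar>a n\<bar> \<le> B" by (auto simp: bounded_iff)
  define w where "w = (\<lambda>k. spow (p - 1) (a (m + int k + 1) - a (m + int k)))"
  have rec: "w (Suc k) = w k + a (m + int k + 1)" for k
  proof -
    have "a (m + int k + 1) = spow (p - 1) (a (m + int k + 1 + 1) - a (m + int k + 1))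
        - spow (p - 1) (a (m + int k + 1) - a (m + int k + 1 - 1))"
      using st unfolding stationary_minus_one by blast
    moreover have "m + int (Suc k) = m + int k + 1" by simp
    ultimately show ?thesis by (simp add: w_def add_ac)
  qed
  have w_nonneg: "0 \<le> w k \<longleftrightarrow> a (m + int k) \<le> a (m + int k + 1)" for k
    using spow_le_iff [of "p - 1" 0] p by (simp add: w_def)
  have grow: "a m \<le> a (m + int k) \<and> real k * a m \<le> w k" for k
  proof (induction k)
    case 0
    then show ?case using w_nonneg [of 0] m by simp
  next
    case (Suc k)
    have "0 \<le> real k * a m" using m by simp
    then have "0 \<le> w k" using Suc by linarith
    then have "a m \<le> a (m + int k + 1)" using w_nonneg Suc by force
    then show ?case using Suc rec [of k] by (simp add: algebra_simps)
  qed
  have "w k \<le> spow (p - 1) (2 * B)" for k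
  proof -
    have "a (m + int k + 1) - a (m + int k) \<le> 2 * B"
      using B [of "m + int k"] B [of "m + int k + 1"] by linarith
    then show ?thesis using p by (simp add: w_def)
  qed
  moreover obtain k where "spow (p - 1) (2 * B) < real k * a m"
    using reals_Archimedean3 m(1) by blast
  ultimately show False using grow [of k] by (smt (verit))
qed

text \<open>Reflection swaps the two fluxes and reverses their signs; this carries the growth
  argument over to the left.\<close>

lemma stationary_reflect:
  assumes "stationary_p_schroedinger p (-1) a"
  shows "stationary_p_schroedinger p (-1) (\<lambda>n. a (- n))"
  unfolding stationary_minus_one
proof
  fix n
  have "a (- n) = spow (p - 1) (a (- n + 1) - a (- n)) - spow (p - 1) (a (- n) - a (- n - 1))"
    using assms unfolding stationary_minus_one by blast
  moreover have "spow (p - 1) (- (a (- n + 1) - a (- n))) = - spow (p - 1) (a (- n + 1) - a (- n))"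
    "spow (p - 1) (- (a (- n) - a (- n - 1))) = - spow (p - 1) (a (- n) - a (- n - 1))"
    by (rule spow_minus)+
  moreover have "- (n + 1) = - n - 1" "- (n - 1) = - n + 1" by auto
  ultimately show "a (- n) = spow (p - 1) (a (- (n + 1)) - a (- n)) - spow (p - 1) (a (- n) - a (- (n - 1)))"
    by simp
qed

lemma stationary_uminus:
  assumes "stationary_p_schroedinger p (-1) a"
  shows "stationary_p_schroedinger p (-1) (\<lambda>n. - a n)"
  unfolding stationary_minus_one
proof
  fix n
  have "a n = spow (p - 1) (a (n + 1) - a n) - spow (p - 1) (a n - a (n - 1))"
    using assms unfolding stationary_minus_one by blast
  moreover have "spow (p - 1) (- (a (n + 1) - a n)) = - spow (p - 1) (a (n + 1) - a n)"
    "spow (p - 1) (- (a n - a (n - 1))) = - spow (p - 1) (a n - a (n - 1))"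
    by (rule spow_minus)+
  ultimately show "- a n = spow (p - 1) (- a (n + 1) - - a n) - spow (p - 1) (- a n - - a (n - 1))"
    by simp
qed

text \<open>By the growth argument in both directions a positive value would be a strict local
  maximum, where the p-Laplacian is negative, contrary to the equation.\<close>

lemma bounded_stationary_nonpos:
  assumes p: "p > 1" and st: "stationary_p_schroedinger p (-1) a" and bd: "bounded (range a)"
  shows "a n \<le> 0"
proof (rule ccontr)
  assume "\<not> ?thesis"
  then have pos: "a n > 0" by simp
  have right: "a (n + 1) < a n"
    using unbounded_if_increasing_step [OF p st pos] bd by force
  have "bounded (range (\<lambda>n. a (- n)))" by (rule bounded_subset [OF bd]) auto
  then have left: "a (n - 1) < a n"
    using unbounded_if_increasing_step [OF p stationary_reflect [OF st], of "- n"] pos by force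
  have "a n = spow (p - 1) (a (n + 1) - a n) - spow (p - 1) (a n - a (n - 1))"
    using st unfolding stationary_minus_one by blast
  moreover have "spow (p - 1) (a (n + 1) - a n) < spow (p - 1) 0"
    "spow (p - 1) 0 < spow (p - 1) (a n - a (n - 1))"
    using left right p by (auto intro!: spow_strict_mono simp del: spow_0)
  ultimately show False using pos by simp
qed

lemma bounded_stationary_iff_zero:
  assumes p: "p > 1"
  shows "stationary_p_schroedinger p (-1) a \<and> bounded (range a) \<longleftrightarrow> (\<forall>n. a n = 0)"
proof (intro iffI allI)
  fix n
  assume a: "stationary_p_schroedinger p (-1) a \<and> bounded (range a)"
  then have "bounded (range (\<lambda>n. - a n))" by (simp add: bounded_iff)
  then have "- a n \<le> 0"
    using bounded_stationary_nonpos [OF p stationary_uminus] a by blast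
  moreover have "a n \<le> 0" using bounded_stationary_nonpos [OF p] a by blast
  ultimately show "a n = 0" by simp
next
  assume a: "\<forall>n. a n = 0"
  then show "stationary_p_schroedinger p (-1) a \<and> bounded (range a)"
    by (auto simp: stationary_minus_one bounded_iff)
qed

theorem theorem1:
  fixes p :: real
  assumes "p > 2"
  shows "(\<exists>a1 a2 :: int \<Rightarrow> real.
            a1 \<noteq> a2 \<and>
            (\<forall>a \<in> {a1, a2}.
               stationary_p_schroedinger p 1 a \<and>
               (a \<longlongrightarrow> 0) at_top \<and> (a \<longlongrightarrow> 0) at_bot \<and>
               (\<forall>n\<le>0. (-1) powi n * a n > 0 \<and> \<bar>a n\<bar> > \<bar>a (n - 1)\<bar>)) \<and>
            (\<forall>n. a1 n = a1 (- n)) \<and>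
            (\<forall>n. a2 n = - a2 (- n + 1)))
         \<and> (\<forall>a :: int \<Rightarrow> real.
            stationary_p_schroedinger p (-1) a \<and> bounded (range a) \<longleftrightarrow> (\<forall>n. a n = 0))"
proof -
  obtain a1 where a1: "localized p a1" "\<And>n. a1 n = a1 (- n)"
    using localized_site_centered [OF assms] by blast
  obtain a2 where a2: "localized p a2" "\<And>n. a2 n = - a2 (- n + 1)"
    using localized_bond_centered [OF assms] by blast
  \<comment> \<open>The solutions differ in amplitude at site 1: evenness makes it equal to that at
    -1, below the one at 0, whereas for \<open>a2\<close> sites 0 and 1 agree in amplitude.\<close>
  have "\<bar>a1 1\<bar> < \<bar>a1 0\<bar>" using a1(1) a1(2) [of 1] by (auto simp: localized_def dest: spec [of _ 0])
  moreover have "\<bar>a2 1\<bar> = \<bar>a2 0\<bar>" using a2(2) [of 0] by simp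
  ultimately have "a1 \<noteq> a2" by auto
  then have first: "a1 \<noteq> a2 \<and> (\<forall>a \<in> {a1, a2}. localized p a) \<and>
      (\<forall>n. a1 n = a1 (- n)) \<and> (\<forall>n. a2 n = - a2 (- n + 1))"
    using a1 a2 by blast
  show ?thesis
  proof (rule conjI)
    show "\<forall>a. stationary_p_schroedinger p (-1) a \<and> bounded (range a) \<longleftrightarrow> (\<forall>n. a n = 0)"
      using bounded_stationary_iff_zero assms by simp
  qed (use first in \<open>unfold localized_def, blast\<close>)
qed

end
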